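(* Let $\mathcal{P}_A,\mathcal{P}_B\in(0,1)$ and let $\mathcal{G}_A=G(\mathcal{P}_A)$, $\mathcal{G}_B=G(\mathcal{P}_B)$ be the corresponding probabilities that $A$, respectively $B$, wins a game on own serve. Let $T$ denote the total number of games in a best-of-three sets match between $A$ and $B$, let $S_1\in\{A,B\}$ be the first server of the first set, and write $T^{\mathrm{match}}_A=\mathbb{E}(T\mid S_1=A)$ and $T^{\mathrm{match}}_B=\mathbb{E}(T\mid S_1=B)$. Assume $\mathcal{G}_A+\mathcal{G}_B>1$. If $\mathcal{G}_A>\mathcal{G}_B$, then $T^{\mathrm{match}}_A<T^{\mathrm{match}}_B$.
   Context: Tennis model with constant serve-point probabilities. Two players $A,B$ play. Each point is won by the player $\sigma\in\{A,B\}$ serving it with probability $\mathcal{P}_\sigma$, independently of all other points. A (non-tiebreak) game served by $\sigma$ is won by $\sigma$ with probability $\mathcal{G}_\sigma=G(\mathcal{P}_\sigma)$, where $$G(x)=x^4\left(15-4x-\frac{10x^2}{1-2x(1-x)}\right),$$ and distinct games are independent. Set: the players alternate serving games, starting with the first server of the set. The set is won by the first player to have won at least 6 games with a lead of at least 2 games; if the score reaches 6-6 a tiebreak is played, which decides the set (final score 7-6) and counts as one game (the 13th), won by the tiebreak winner. Hence the possible final scores are 6-0, 6-1, 6-2, 6-3, 6-4, 7-5, 7-6 in favour of either player, and the total number of games is the sum of the two numbers in the score. Tiebreak: the first server of the set serves the first point of the tiebreak; then the opponent serves two points, then the first server two points, and so on alternately in blocks of two; the tiebreak is won by the first player with at least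 7 points and a lead of at least 2 points. Match: sets (each of them, including a third set, won by the first player to have won at least 6 games with a lead of at least 2 games, or by the winner of a tiebreak if the score reaches 6-6) are played until one player has won two sets, so 2 or 3 sets are played. Alternation of serve continues across sets, a tiebreak counting as one game: if a set consists of an even number of games, its first server also serves first in the next set; if it consists of an odd number of games, the other player serves first in the next set. Given its first server, each set is independent of the preceding ones. $\mathbb{E}(\,\cdot\mid S_1=\sigma)$ means the expectation in the model for a match whose first set is started by server $\sigma$. *)

theory Defs
  imports "HOL-Probability.Probability"
begin

text \<open>
  Throughout, \<open>P :: player \<Rightarrow> real\<close> gives the probability with which a player wins a
  point on own serve.
\<close>

datatype player = A | B

fun opponent :: "player \<Rightarrow> player" where
  "opponent A = B"
| "opponent B = A"

text \<open>The winner of a trial that \<open>x\<close> wins with probability \<open>q\<close>.\<close>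

definition winner_pmf :: "real \<Rightarrow> player \<Rightarrow> player pmf" where
  "winner_pmf q x = map_pmf (\<lambda>b. if b then x else opponent x) (bernoulli_pmf q)"

definition G :: "real \<Rightarrow> real" where
  "G x = x ^ 4 * (15 - 4 * x - 10 * x\<^sup>2 / (1 - 2 * x * (1 - x)))"

definition game_pmf :: "(player \<Rightarrow> real) \<Rightarrow> player \<Rightarrow> player pmf" where
  "game_pmf P s = winner_pmf (G (P s)) s"

text \<open>
  Tiebreaks. Points are numbered from 0, so that \<open>(k + 1) div 2\<close> is the index of the
  service block containing point \<open>k\<close>: blocks \<open>{0}\<close>, \<open>{1, 2}\<close>, \<open>{3, 4}\<close>, and so on.
  The sample space consists of infinite sequences of point winners; the points after the
  decision of the tiebreak are irrelevant to its winner.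
\<close>

definition tb_server :: "player \<Rightarrow> nat \<Rightarrow> player" where
  "tb_server s k = (if even ((k + 1) div 2) then s else opponent s)"

definition tb_space :: "(player \<Rightarrow> real) \<Rightarrow> player \<Rightarrow> (nat \<Rightarrow> player) measure" where
  "tb_space P s =
    (\<Pi>\<^sub>M k\<in>UNIV. measure_pmf (winner_pmf (P (tb_server s k)) (tb_server s k)))"

definition tb_points :: "(nat \<Rightarrow> player) \<Rightarrow> player \<Rightarrow> nat \<Rightarrow> nat" where
  "tb_points \<omega> x n = card {k. k < n \<and> \<omega> k = x}"

definition tb_reached :: "(nat \<Rightarrow> player) \<Rightarrow> player \<Rightarrow> nat \<Rightarrow> bool" where
  "tb_reached \<omega> x n \<longleftrightarrow>
    tb_points \<omega> x n \<ge> 7 \<and> tb_points \<omega> x n \<ge> tb_points \<omega> (opponent x) n + 2"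

definition tb_won :: "(nat \<Rightarrow> player) \<Rightarrow> player \<Rightarrow> bool" where
  "tb_won \<omega> x \<longleftrightarrow> (\<exists>n. tb_reached \<omega> x n \<and> (\<forall>m<n. \<not> tb_reached \<omega> (opponent x) m))"

text \<open>
  If \<open>P A\<close> and \<open>P B\<close> lie strictly between 0 and 1, then a tiebreak ends almost surely,
  so \<open>B\<close> wins it with the complementary probability.
\<close>

definition tiebreak_pmf :: "(player \<Rightarrow> real) \<Rightarrow> player \<Rightarrow> player pmf" where
  "tiebreak_pmf P s =
    winner_pmf (measure (tb_space P s) {\<omega> \<in> space (tb_space P s). tb_won \<omega> A}) A"

text \<open>
  Scores are pairs, \<open>A\<close>'s games first. A set that has reached 13 games was decided by the
  tiebreak, which is the 13th game.
\<close>

definition set_over :: "nat \<Rightarrow> nat \<Rightarrow> bool" where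
  "set_over i j \<longleftrightarrow> (i \<ge> 6 \<and> i \<ge> j + 2) \<or> (j \<ge> 6 \<and> j \<ge> i + 2) \<or> i + j \<ge> 13"

text \<open>
  The final score of a set whose current score is \<open>(i, j)\<close> and whose next game is served
  (or, for the tiebreak, whose first point is served) by \<open>s\<close>. The tiebreak is preceded by
  12 games, so then \<open>s\<close> is the first server of the set.
\<close>

function set_score :: "(player \<Rightarrow> real) \<Rightarrow> player \<Rightarrow> nat \<Rightarrow> nat \<Rightarrow> (nat \<times> nat) pmf" where
  "set_score P s i j =
    (if set_over i j then return_pmf (i, j)
     else bind_pmf (if i = 6 \<and> j = 6 then tiebreak_pmf P s else game_pmf P s)
       (\<lambda>w. case w of
              A \<Rightarrow> set_score P (opponent s) (Suc i) j
            | B \<Rightarrow> set_score P (opponent s) i (Suc j)))"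
  by pat_completeness auto
termination
  by (relation "Wellfounded.measure (\<lambda>(P, s, i, j). 13 - (i + j))") (auto simp: set_over_def)

declare set_score.simps [simp del]

text \<open>
  The list of the final scores of the remaining sets of a match in which \<open>A\<close> has won \<open>a\<close>
  sets and \<open>B\<close> has won \<open>b\<close> sets so far, and whose next set is started by server \<open>s\<close>.
\<close>

function match_scores ::
  "(player \<Rightarrow> real) \<Rightarrow> player \<Rightarrow> nat \<Rightarrow> nat \<Rightarrow> (nat \<times> nat) list pmf" where
  "match_scores P s a b =
    (if a \<ge> 2 \<or> b \<ge> 2 then return_pmf []
     else bind_pmf (set_score P s 0 0)
       (\<lambda>(i, j).
          let s' = (if even (i + j) then s else opponent s)
          in map_pmf ((#) (i, j))
               (if i > j then match_scores P s' (Suc a) b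
                else match_scores P s' a (Suc b))))"
  by pat_completeness auto
termination
  by (relation "Wellfounded.measure (\<lambda>(P, s, a, b). 4 - (a + b))") auto

declare match_scores.simps [simp del]

definition total_games :: "(nat \<times> nat) list \<Rightarrow> nat" where
  "total_games scores = (\<Sum>(i, j)\<leftarrow>scores. i + j)"

definition T_match :: "(player \<Rightarrow> real) \<Rightarrow> player \<Rightarrow> real" where
  "T_match P s =
    measure_pmf.expectation (match_scores P s 0 0) (\<lambda>scores. real (total_games scores))"

end

theory Submission
  imports Defs
begin

text \<open>
  Consecutive games come in pairs in which each player serves once. How many games of a complete
  pair \<open>A\<close> wins has the same distribution whoever serves first in it, so before a tiebreak the
  first server of a set matters only if the set ends in the middle of a pair.

  For the winner of a set it does not matter even then: when the set ends there, with 6-1 or 6-3,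
  the lead of the winner is at least 3, so the second game of the pair could be played without
  changing the winner. The same argument, with points in place of games, applies to the
  tiebreak. Hence the winner of a set has the same distribution for both first servers
  (\<open>tiebreak_pmf_opponent\<close>, \<open>won_by_A_indep_server\<close>).

  For the mean length of a set it does matter, at the scores 5-1, 5-3, 1-5 and 3-5, where the set
  can end after one more game. At 5-1 and 5-3 the set tends to be shorter if \<open>A\<close> serves next, at
  1-5 and 3-5 if \<open>B\<close> does, because \<open>G (P A) + G (P B) > 1\<close> says that \<open>A\<close> wins a game more
  probably on own serve than on the serve of \<open>B\<close>. Because \<open>A\<close> is the better player, the former
  scores are visited more often than the latter; so a set started by \<open>A\<close> is shorter in the mean
  (\<open>length_gap_start\<close>, \<open>length_gap_start_neg\<close>).

  In a match, the first server influences the later sets through the parity of the number of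
  games in the earlier ones. Since the winner of a set is independent of its first server, the
  difference of the mean match lengths is the difference of the mean set lengths times a factor
  that collects these influences (\<open>T_match_diff\<close>), and this factor is positive
  (\<open>match_factor_pos\<close>).
\<close>

section \<open>The two players\<close>

lemma UNIV_player: "(UNIV :: player set) = {A, B}"
  using player.exhaust by blast

instance player :: finite
  by standard (simp add: UNIV_player)

lemma opponent_opponent [simp]: "opponent (opponent s) = s"
  by (cases s) auto

section \<open>The probability of winning a game\<close>

lemma deuce_pos: "0 < 1 - 2 * x * (1 - x)" for x :: real
proof -
  have "1 - 2 * x * (1 - x) = (1 / 2) + 2 * (x - 1 / 2)\<^sup>2"
    by (simp add: power2_eq_square algebra_simps)
  then show ?thesis
    by (metis add_pos_nonneg half_gt_zero_iff mult_nonneg_nonneg zero_le_numeral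
        zero_le_power2 zero_less_one)
qed

lemma G_pos:
  assumes "0 < x" "x < 1"
  shows "0 < G x"
proof -
  define y where "y = 1 - x"
  have "y > 0" using assms by (simp add: y_def)
  (* Over the common denominator, the numerator has positive coefficients when it is
     written in the losing probability y of a point. *)
  have "(15 - 4 * x) * (1 - 2 * x * (1 - x)) - 10 * x\<^sup>2 = 1 + 2 * y + 4 * y\<^sup>2 + 8 * y ^ 3"
    by (simp add: y_def power2_eq_square power3_eq_cube algebra_simps)
  also have "\<dots> > 0"
    using \<open>y > 0\<close> by (intro add_pos_pos) auto
  finally have "0 < (15 - 4 * x) - 10 * x\<^sup>2 / (1 - 2 * x * (1 - x))"
    using deuce_pos[of x] by (simp add: field_simps)
  then show ?thesis
    unfolding G_def using \<open>0 < x\<close> by simp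
qed

text \<open>
  The receiver wins each point with probability \<open>1 - x\<close>, and the rules of a game treat both
  players alike; so the receiver wins the game with probability \<open>G (1 - x)\<close>.
\<close>

lemma G_reflect: "G x + G (1 - x) = 1"
proof -
  define d where "d = 1 - 2 * x * (1 - x)"
  have "d > 0" using deuce_pos by (simp add: d_def)
  have G_d: "G y * d = y ^ 4 * ((15 - 4 * y) * d - 10 * y\<^sup>2)" if "1 - 2 * y * (1 - y) = d" for y
    using \<open>d > 0\<close> unfolding G_def that by (simp add: field_simps)
  have "(G x + G (1 - x)) * d
     = x ^ 4 * ((15 - 4 * x) * d - 10 * x\<^sup>2)
     + (1 - x) ^ 4 * ((15 - 4 * (1 - x)) * d - 10 * (1 - x)\<^sup>2)"
    unfolding distrib_right by (subst (1 2) G_d) (simp_all add: d_def algebra_simps)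
  also have "\<dots> = d"
    unfolding d_def by algebra
  finally show ?thesis
    using \<open>d > 0\<close> by simp
qed

lemma G_less_1:
  assumes "0 < x" "x < 1"
  shows "G x < 1"
  using G_pos[of "1 - x"] G_reflect[of x] assms by simp

lemma pmf_winner:
  assumes "0 \<le> q" "q \<le> 1"
  shows "pmf (winner_pmf q x) x = q" "pmf (winner_pmf q x) (opponent x) = 1 - q"
proof -
  have "pmf (winner_pmf q x) x = pmf (bernoulli_pmf q) True"
    unfolding winner_pmf_def
    by (subst pmf_map_inj'[of "\<lambda>b. if b then x else opponent x" "bernoulli_pmf q" True, symmetric])
      (cases x; auto simp: inj_def)+
  moreover have "pmf (winner_pmf q x) (opponent x) = pmf (bernoulli_pmf q) False"
    unfolding winner_pmf_def
    by (subst pmf_map_inj'[of "\<lambda>b. if b then x else opponent x" "bernoulli_pmf q" False, symmetric])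
      (cases x; auto simp: inj_def)+
  ultimately show "pmf (winner_pmf q x) x = q" "pmf (winner_pmf q x) (opponent x) = 1 - q"
    using assms by simp_all
qed

section \<open>The tiebreak winner does not depend on the first server\<close>

text \<open>
  Pair the points of a tiebreak as 0 and 1, 2 and 3, and so on. Each player serves one point
  of every pair, and changing the first server exchanges the two servers in every pair. So
  exchanging the two points of every pair turns the tiebreak started by one player
  into the tiebreak started by the other. It remains to see that the winner can
  be read off from the scores after complete pairs.
\<close>

definition swap_pairs :: "nat \<Rightarrow> nat" where
  "swap_pairs k = (if even k then k + 1 else k - 1)"

lemma swap_pairs_swap_pairs [simp]: "swap_pairs (swap_pairs k) = k"
  by (auto simp: swap_pairs_def)

lemma inj_swap_pairs: "inj swap_pairs"
  by (metis injI swap_pairs_swap_pairs)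

lemma swap_pairs_less_iff: "even n \<Longrightarrow> swap_pairs k < n \<longleftrightarrow> k < n"
  by (auto simp: swap_pairs_def elim!: evenE oddE)

lemma tb_server_swap_pairs: "tb_server s (swap_pairs k) = tb_server (opponent s) k"
  by (auto simp: tb_server_def swap_pairs_def elim!: evenE oddE)

lemma tb_points_swap_pairs:
  assumes "even n"
  shows "tb_points (\<lambda>k. \<omega> (swap_pairs k)) x n = tb_points \<omega> x n"
proof -
  have "bij_betw swap_pairs {k. k < n \<and> \<omega> (swap_pairs k) = x} {k. k < n \<and> \<omega> k = x}"
    by (rule bij_betwI[where g = swap_pairs])
      (use assms in \<open>auto simp: swap_pairs_less_iff\<close>)
  then show ?thesis
    unfolding tb_points_def by (rule bij_betw_same_card)
qed

lemma tb_points_add_opponent: "tb_points \<omega> x n + tb_points \<omega> (opponent x) n = n"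
proof -
  have "\<omega> k = x \<or> \<omega> k = opponent x" for k
    by (cases x; cases "\<omega> k") auto
  then have "{k. k < n \<and> \<omega> k = x} \<union> {k. k < n \<and> \<omega> k = opponent x} = {..<n}"
    by auto
  moreover have "{k. k < n \<and> \<omega> k = x} \<inter> {k. k < n \<and> \<omega> k = opponent x} = {}"
    by (cases x) auto
  ultimately show ?thesis
    unfolding tb_points_def
    by (metis card_Un_disjoint card_lessThan finite_Un finite_lessThan)
qed

lemma tb_points_Suc:
  "tb_points \<omega> x (Suc n) = tb_points \<omega> x n + (if \<omega> n = x then 1 else 0)"
proof -
  have "{k. k < Suc n \<and> \<omega> k = x} = {k. k < n \<and> \<omega> k = x} \<union> (if \<omega> n = x then {n} else {})"
    by (auto simp: less_Suc_eq)
  then show ?thesis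
    unfolding tb_points_def by (simp add: card_insert_if)
qed

text \<open>
  After an odd number of points the lead is odd, so a lead of at least 2 is a lead of at
  least 3 and survives one more lost point.
\<close>

lemma tb_reached_Suc:
  assumes "odd n" "tb_reached \<omega> x n"
  shows "tb_reached \<omega> x (Suc n)"
proof -
  have "tb_points \<omega> x n \<noteq> tb_points \<omega> (opponent x) n + 2"
    using tb_points_add_opponent[of \<omega> x n] \<open>odd n\<close> by presburger
  then show ?thesis
    using assms(2) unfolding tb_reached_def
    using tb_points_Suc[of \<omega> x n] tb_points_Suc[of \<omega> "opponent x" n]
    by (auto split: if_splits)
qed

lemma not_tb_reached_both: "tb_reached \<omega> x n \<Longrightarrow> \<not> tb_reached \<omega> (opponent x) n"
  by (auto simp: tb_reached_def)

text \<open>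
  Who first meets the winning condition after an odd number of points still meets it one point
  later, and the opponent cannot have met it in between.
\<close>

lemma tb_won_iff_even:
  "tb_won \<omega> x \<longleftrightarrow>
    (\<exists>n. even n \<and> tb_reached \<omega> x n \<and> (\<forall>m<n. even m \<longrightarrow> \<not> tb_reached \<omega> (opponent x) m))"
    (is "_ \<longleftrightarrow> ?even_won")
proof
  assume "tb_won \<omega> x"
  then obtain n where n: "tb_reached \<omega> x n" "\<forall>m<n. \<not> tb_reached \<omega> (opponent x) m"
    by (auto simp: tb_won_def)
  show ?even_won
  proof (cases "even n")
    case True
    with n show ?thesis by blast
  next
    case False
    with n have "tb_reached \<omega> x (Suc n)" "even (Suc n)"
      by (auto intro: tb_reached_Suc)
    moreover have "\<forall>m<Suc n. \<not> tb_reached \<omega> (opponent x) m"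
      using n not_tb_reached_both by (auto simp: less_Suc_eq)
    ultimately show ?thesis by blast
  qed
next
  assume ?even_won
  then obtain n where n: "even n" "tb_reached \<omega> x n"
      "\<And>m. m < n \<Longrightarrow> even m \<Longrightarrow> \<not> tb_reached \<omega> (opponent x) m"
    by blast
  have "\<not> tb_reached \<omega> (opponent x) m" if "m < n" for m
  proof (cases "even m")
    case False
    show ?thesis
    proof
      assume "tb_reached \<omega> (opponent x) m"
      with False have "tb_reached \<omega> (opponent x) (Suc m)" "even (Suc m)"
        by (auto intro: tb_reached_Suc)
      moreover have "Suc m < n \<or> Suc m = n"
        using that by auto
      ultimately show False
        using n not_tb_reached_both by blast
    qed
  qed (use n that in auto)
  with n show "tb_won \<omega> x"
    by (auto simp: tb_won_def)
qed

text \<open>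
  Scores at even times do not see the order of the points within a pair.
\<close>

lemma tb_won_swap_pairs: "tb_won (\<lambda>k. \<omega> (swap_pairs k)) x \<longleftrightarrow> tb_won \<omega> x"
  by (simp add: tb_won_iff_even tb_reached_def tb_points_swap_pairs cong: conj_cong imp_cong)

lemma measurable_tb_points:
  "(\<lambda>\<omega>. tb_points \<omega> x n) \<in> measurable (tb_space P s) (count_space UNIV)"
proof -
  have *: "tb_points \<omega> x n = (\<Sum>k<n. if \<omega> k = x then 1 else 0)" for \<omega>
    by (induction n) (simp_all add: tb_points_Suc, simp add: tb_points_def)
  show ?thesis
    unfolding * tb_space_def by measurable
qed

lemma sets_tb_won: "{\<omega> \<in> space (tb_space P s). tb_won \<omega> x} \<in> sets (tb_space P s)"
proof -
  note measurable_tb_points [measurable]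
  show ?thesis
    unfolding tb_won_def tb_reached_def by measurable
qed

lemma tiebreak_pmf_opponent: "tiebreak_pmf P (opponent s) = tiebreak_pmf P s"
proof -
  let ?M = "\<lambda>k. measure_pmf (winner_pmf (P (tb_server s k)) (tb_server s k))"
  let ?swap = "\<lambda>\<omega> k. \<omega> (swap_pairs k) :: player"
  have opp: "tb_space P (opponent s) = (\<Pi>\<^sub>M k\<in>UNIV. ?M (swap_pairs k))"
    by (simp add: tb_space_def tb_server_swap_pairs)
  have distr: "distr (tb_space P s) (tb_space P (opponent s)) ?swap = tb_space P (opponent s)"
    using distr_PiM_reindex[of UNIV ?M swap_pairs UNIV] inj_swap_pairs
    unfolding opp by (simp add: tb_space_def restrict_def measure_pmf.prob_space_axioms)
  have "?swap \<in> measurable (tb_space P s) (tb_space P (opponent s))"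
    unfolding opp tb_space_def by (rule measurable_PiM_single') (auto simp: space_PiM)
  then have "measure (tb_space P (opponent s)) {\<omega> \<in> space (tb_space P (opponent s)). tb_won \<omega> A}
     = measure (tb_space P s)
         (?swap -` {\<omega> \<in> space (tb_space P (opponent s)). tb_won \<omega> A} \<inter> space (tb_space P s))"
    by (subst distr[symmetric], subst measure_distr) (simp_all add: sets_tb_won)
  also have "?swap -` {\<omega> \<in> space (tb_space P (opponent s)). tb_won \<omega> A} \<inter> space (tb_space P s)
     = {\<omega> \<in> space (tb_space P s). tb_won \<omega> A}"
    by (auto simp: tb_won_swap_pairs tb_space_def space_PiM)
  finally show ?thesis
    by (simp add: tiebreak_pmf_def)
qed

section \<open>Expectations over the score of a set\<close>

lemma expectation_bind_finite:
  fixes h :: "'b \<Rightarrow> real"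
  assumes "finite (set_pmf p)" "\<And>x. finite (set_pmf (f x))"
  shows "measure_pmf.expectation (bind_pmf p f) h
       = measure_pmf.expectation p (\<lambda>x. measure_pmf.expectation (f x) h)"
  using assms by (simp add: pmf_expectation_bind[of "set_pmf p"] integral_measure_pmf[of "set_pmf p"])

lemma pmf_player_B: "pmf p B = 1 - pmf p A" for p :: "player pmf"
  using sum_pmf_eq_1[of UNIV p] by (simp add: UNIV_player[symmetric]) (simp add: UNIV_player)

lemma finite_set_score: "finite (set_pmf (set_score P s i j))"
proof (induction P s i j rule: set_score.induct)
  case (1 P s i j)
  then show ?case
    by (subst set_score.simps) (auto split: player.split)
qed

definition set_mean ::
  "(player \<Rightarrow> real) \<Rightarrow> (nat \<times> nat \<Rightarrow> real) \<Rightarrow> player \<Rightarrow> nat \<Rightarrow> nat \<Rightarrow> real" where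
  "set_mean P f s i j = measure_pmf.expectation (set_score P s i j) f"

lemma set_mean_over [simp]: "set_over i j \<Longrightarrow> set_mean P f s i j = f (i, j)"
  by (simp add: set_mean_def set_score.simps[of P s i j])

lemma set_mean_step:
  fixes P s i j
  defines "w \<equiv> pmf (if i = 6 \<and> j = 6 then tiebreak_pmf P s else game_pmf P s) A"
  assumes "\<not> set_over i j"
  shows "set_mean P f s i j =
    w * set_mean P f (opponent s) (Suc i) j + (1 - w) * set_mean P f (opponent s) i (Suc j)"
proof -
  define W where "W = (if i = 6 \<and> j = 6 then tiebreak_pmf P s else game_pmf P s)"
  have "set_score P s i j = bind_pmf W (\<lambda>w. case w of
              A \<Rightarrow> set_score P (opponent s) (Suc i) j
            | B \<Rightarrow> set_score P (opponent s) i (Suc j))"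
    using assms(2) by (simp add: set_score.simps[of P s i j] W_def)
  moreover have "finite (set_pmf (case w of
              A \<Rightarrow> set_score P (opponent s) (Suc i) j
            | B \<Rightarrow> set_score P (opponent s) i (Suc j)))" for w
    by (cases w) (simp_all add: finite_set_score)
  ultimately show ?thesis
    unfolding set_mean_def w_def W_def[symmetric]
    by (simp add: expectation_bind_finite
        integral_measure_pmf[of UNIV])
      (simp add: UNIV_player pmf_player_B)
qed

text \<open>
  The game is always seen from \<open>A\<close>, also when \<open>B\<close> serves: so both kinds of games are steps of
  one random walk of the score.
\<close>

abbreviation win_prob :: "(player \<Rightarrow> real) \<Rightarrow> player \<Rightarrow> real" where
  "win_prob P s \<equiv> pmf (game_pmf P s) A"

lemma set_mean_game:
  assumes "\<not> set_over i j" "i + j < 12"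
  shows "set_mean P f s i j =
    win_prob P s * set_mean P f (opponent s) (Suc i) j
    + (1 - win_prob P s) * set_mean P f (opponent s) i (Suc j)"
  using set_mean_step[OF assms(1), of P f s] assms(2) by simp

lemma not_set_over_cases: "\<not> set_over i j \<Longrightarrow> i + j < 12 \<or> (i = 6 \<and> j = 6)"
  by (auto simp: set_over_def)

lemma win_prob_eq:
  assumes "0 < P A" "P A < 1" "0 < P B" "P B < 1"
  shows "win_prob P A = G (P A)" "win_prob P B = 1 - G (P B)"
  using pmf_winner[of "G (P A)" A] pmf_winner[of "G (P B)" B]
    G_pos[of "P A"] G_less_1[of "P A"] G_pos[of "P B"] G_less_1[of "P B"] assms
  by (simp_all add: game_pmf_def)

text \<open>
  Two consecutive games are served once by each player, in an order that depends on who
  serves next. The probabilities that \<open>A\<close> wins both of them, exactly one, or none do not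
  depend on that order.
\<close>

definition win_both :: "(player \<Rightarrow> real) \<Rightarrow> real" where
  "win_both P = win_prob P A * win_prob P B"

definition win_one :: "(player \<Rightarrow> real) \<Rightarrow> real" where
  "win_one P = win_prob P A * (1 - win_prob P B) + (1 - win_prob P A) * win_prob P B"

definition win_none :: "(player \<Rightarrow> real) \<Rightarrow> real" where
  "win_none P = (1 - win_prob P A) * (1 - win_prob P B)"

text \<open>
  As long as the set cannot end in between, two games move the score by steps whose
  probabilities are the same for both servers, and restore the server.
\<close>

lemma set_mean_two_games:
  assumes "\<not> set_over i j" "\<not> set_over (i + 1) j" "\<not> set_over i (j + 1)" "i + j < 11"
  shows "set_mean P f s i j =
    win_both P * set_mean P f s (i + 2) j + win_one P * set_mean P f s (i + 1) (j + 1)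
    + win_none P * set_mean P f s i (j + 2)"
  using assms
  by (cases s) (simp_all add: set_mean_game win_both_def win_one_def win_none_def algebra_simps)

section \<open>The set winner does not depend on the first server\<close>

abbreviation won_by_A :: "nat \<times> nat \<Rightarrow> real" where
  "won_by_A \<equiv> \<lambda>(i, j). of_bool (j < i)"

text \<open>
  For the question who wins, the set may be thought to continue when it ends after the first
  of the two games: the lead is then at least 3 because the number of games is odd, so
  the winner keeps a lead of at least 2 whatever the next game brings. Hence the two-game
  recursion holds after any even number of games, up to the tiebreak.
\<close>

lemma won_by_A_two_games:
  assumes "\<not> set_over i j" "even (i + j)" "i + j < 12"
  shows "set_mean P won_by_A s i j =
    win_both P * set_mean P won_by_A s (i + 2) j + win_one P * set_mean P won_by_A s (i + 1) (j + 1)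
    + win_none P * set_mean P won_by_A s i (j + 2)"
proof -
  have "i + j < 11" using assms by presburger
  consider "\<not> set_over (i + 1) j" "\<not> set_over i (j + 1)"
    | "set_over (i + 1) j" | "set_over i (j + 1)" by blast
  then show ?thesis
  proof cases
    case 1
    then show ?thesis using assms \<open>i + j < 11\<close> by (intro set_mean_two_games) auto
  next
    case 2
    then have "i = 5 \<and> (j = 1 \<or> j = 3)"
      using assms unfolding set_over_def by presburger
    then show ?thesis
      by (cases s)
       (auto simp: set_mean_game set_over_def win_both_def win_one_def win_none_def algebra_simps)
  next
    case 3
    then have "j = 5 \<and> (i = 1 \<or> i = 3)"
      using assms unfolding set_over_def by presburger
    then show ?thesis
      by (cases s)
       (auto simp: set_mean_game set_over_def win_both_def win_one_def win_none_def algebra_simps)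
  qed
qed

lemma won_by_A_indep_server:
  assumes "even (i + j)"
  shows "set_mean P won_by_A s i j = set_mean P won_by_A (opponent s) i j"
  using assms
proof (induction "13 - (i + j)" arbitrary: i j rule: less_induct)
  case less
  show ?case
  proof (cases "set_over i j")
    case False
    then consider "i + j < 12" | "i = 6" "j = 6" using not_set_over_cases by blast
    then show ?thesis
    proof cases
      case 1
      then show ?thesis
        using False less.prems less.hyps
        by (simp add: won_by_A_two_games)
    next
      case 2
      then show ?thesis
        using False by (simp add: set_mean_step tiebreak_pmf_opponent set_over_def)
    qed
  qed simp
qed

text \<open>
  Either player may win the first six games.
\<close>

lemma won_by_A_strict:
  assumes "0 < win_prob P A" "win_prob P A < 1" "0 < win_prob P B" "win_prob P B < 1"
  shows "0 < set_mean P won_by_A s 0 0" "set_mean P won_by_A s 0 0 < 1"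
proof -
  have pq: "0 < win_prob P s" "win_prob P s < 1" for s
    using assms by (cases s; simp)+
  have bounds: "0 \<le> set_mean P won_by_A s i j" "set_mean P won_by_A s i j \<le> 1" for s i j
    unfolding set_mean_def
    by (auto intro!: integral_nonneg_AE measure_pmf.integral_le_const
         integrable_measure_pmf_finite finite_set_score)
  have "0 < set_mean P won_by_A s i 0" if "i \<le> 6" for i s
    using that
  proof (induction i arbitrary: s rule: inc_induct)
    case base
    show ?case by (simp add: set_over_def)
  next
    case (step n)
    then show ?case
      using pq bounds
      by (subst set_mean_game) (auto simp: set_over_def less_imp_le intro!: add_pos_nonneg)
  qed
  then show "0 < set_mean P won_by_A s 0 0" by simp
  have "set_mean P won_by_A s 0 j < 1" if "j \<le> 6" for j s
    using that
  proof (induction j arbitrary: s rule: inc_induct)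
    case base
    show ?case by (simp add: set_over_def)
  next
    case (step n)
    have "set_mean P won_by_A s 0 n
      = win_prob P s * set_mean P won_by_A (opponent s) 1 n
        + (1 - win_prob P s) * set_mean P won_by_A (opponent s) 0 (Suc n)"
      using step by (subst set_mean_game) (auto simp: set_over_def)
    also have "\<dots> < win_prob P s * 1 + (1 - win_prob P s) * 1"
      using pq[of s] bounds step.IH
      by (intro add_le_less_mono mult_left_mono mult_strict_left_mono) auto
    finally show ?case by simp
  qed
  then show "set_mean P won_by_A s 0 0 < 1" by simp
qed

section \<open>The first server and the mean length of a set\<close>

abbreviation set_length :: "nat \<times> nat \<Rightarrow> real" where
  "set_length \<equiv> \<lambda>(i, j). real (i + j)"

definition length_gap :: "(player \<Rightarrow> real) \<Rightarrow> nat \<Rightarrow> nat \<Rightarrow> real" where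
  "length_gap P i j = set_mean P set_length A i j - set_mean P set_length B i j"

lemma length_gap_over: "set_over i j \<Longrightarrow> length_gap P i j = 0"
  by (simp add: length_gap_def)

lemma length_gap_tiebreak: "length_gap P 6 6 = 0"
  by (simp add: length_gap_def set_mean_step set_over_def algebra_simps)

lemma length_gap_two_games:
  assumes "\<not> set_over i j" "\<not> set_over (i + 1) j" "\<not> set_over i (j + 1)" "i + j < 11"
  shows "length_gap P i j =
    win_both P * length_gap P (i + 2) j + win_one P * length_gap P (i + 1) (j + 1)
    + win_none P * length_gap P i (j + 2)"
  using set_mean_two_games[OF assms, of P set_length]
  by (simp add: length_gap_def algebra_simps)

text \<open>
  From 5-1 or 5-3 the set ends at once if \<open>A\<close> wins the next game, and the chance of that
  depends on the server. If \<open>A\<close> wins just one of the next two games, the set ends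
  either after the first or after the second of them; the probability of winning one or
  more of them is the same for both servers. So the server matters by exactly one game, with
  weight the difference of the two winning probabilities.
\<close>

lemma length_gap_A_at_5:
  assumes "j = 1 \<or> j = 3"
  shows "length_gap P 5 j
    = - (win_prob P A - win_prob P B) + win_none P * length_gap P 5 (j + 2)"
  using assms
  by (auto simp: length_gap_def set_mean_game set_over_def win_none_def algebra_simps)

lemma length_gap_B_at_5:
  assumes "i = 1 \<or> i = 3"
  shows "length_gap P i 5
    = (win_prob P A - win_prob P B) + win_both P * length_gap P (i + 2) 5"
  using assms
  by (auto simp: length_gap_def set_mean_game set_over_def win_both_def algebra_simps)

text \<open>
  The gap is collected where the set can end after an odd number of games, at 5-1 and 5-3
  with one sign, at 1-5 and 3-5 with the other. So it is
  \<open>win_prob P A - win_prob P B\<close> times the probability that the two-game walk visits 1-5,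
  plus that for 3-5, minus those for 5-1 and 5-3. The visit probabilities are
  \<open>3 c\<^sub>0\<^sup>2 c\<^sub>1\<close> for 1-5 and \<open>4 c\<^sub>0 c\<^sub>1\<^sup>3 + 12 c\<^sub>0\<^sup>2 c\<^sub>1 c\<^sub>2\<close> for 3-5, where \<open>c\<^sub>k\<close> is the
  probability that \<open>A\<close> wins \<open>k\<close> games out of two; exchanging \<open>c\<^sub>0\<close> and \<open>c\<^sub>2\<close> gives those
  for 5-1 and 5-3. The difference has the factor \<open>c\<^sub>0 - c\<^sub>2\<close>.
\<close>

lemma length_gap_start:
  "length_gap P 0 0 = (win_prob P A - win_prob P B) * (win_none P - win_both P) * win_one P
      * (3 * (win_none P + win_both P) + 4 * (win_one P)\<^sup>2 + 12 * win_none P * win_both P)"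
proof -
  define d where "d = win_prob P A - win_prob P B"
  note two = length_gap_two_games[of _ _ P]
  note over = length_gap_over set_over_def
  (* The label k stands for the scores after k games; the recursion runs backwards in k.
     Without One_nat_def, the scores stay numerals and match the earlier facts. *)
  have 10: "length_gap P 5 5 = 0"
    using two[of 5 5] by (simp add: over length_gap_tiebreak)
  have 8: "length_gap P 5 3 = - d" "length_gap P 4 4 = 0" "length_gap P 3 5 = d"
    using length_gap_A_at_5[of 3 P] length_gap_B_at_5[of 3 P] two[of 4 4]
    by (simp_all add: over 10 d_def)
  have 6: "length_gap P 5 1 = - d - win_none P * d" "length_gap P 4 2 = - (win_one P * d)"
      "length_gap P 3 3 = (win_none P - win_both P) * d" "length_gap P 2 4 = win_one P * d"
      "length_gap P 1 5 = d + win_both P * d"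
    using length_gap_A_at_5[of 1 P] length_gap_B_at_5[of 1 P]
      two[of 4 2] two[of 3 3] two[of 2 4]
    by (simp_all add: over 8 d_def[symmetric] algebra_simps
        del: One_nat_def add_2_eq_Suc add_2_eq_Suc')
  note 4 = two[of 4 0] two[of 3 1] two[of 2 2] two[of 1 3] two[of 0 4]
  note 2 = two[of 2 0] two[of 1 1] two[of 0 2]
  show ?thesis
    using two[of 0 0] 4 2
    unfolding d_def[symmetric]
    by (simp add: over 6 8 algebra_simps power2_eq_square
        del: One_nat_def add_2_eq_Suc add_2_eq_Suc')
qed

text \<open>
  By \<open>win_prob_eq\<close>, the last two hypotheses stand for \<open>G (P A) + G (P B) > 1\<close> and
  \<open>G (P A) > G (P B)\<close>, in this order. The latter makes it more likely that \<open>A\<close> wins both of two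
  games than none.
\<close>

lemma length_gap_start_neg:
  assumes "0 < win_prob P A" "win_prob P A < 1" "0 < win_prob P B" "win_prob P B < 1"
    and "win_prob P B < win_prob P A" "1 < win_prob P A + win_prob P B"
  shows "length_gap P 0 0 < 0"
proof -
  have "win_none P > 0" "win_one P > 0" "win_both P > 0"
    using assms by (auto simp: win_none_def win_one_def win_both_def intro!: add_pos_pos)
  moreover have "win_none P - win_both P < 0"
    using assms by (simp add: win_none_def win_both_def algebra_simps)
  ultimately show ?thesis
    unfolding length_gap_start using assms
    by (intro mult_neg_pos mult_pos_neg add_pos_pos mult_pos_pos) auto
qed

section \<open>From sets to matches\<close>

lemma finite_match_scores: "finite (set_pmf (match_scores P s a b))"
proof (induction P s a b rule: match_scores.induct)
  case (1 P s a b)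
  then show ?case
    by (subst match_scores.simps) (auto simp: finite_set_score Let_def split: if_splits)
qed

definition match_mean :: "(player \<Rightarrow> real) \<Rightarrow> player \<Rightarrow> nat \<Rightarrow> nat \<Rightarrow> real" where
  "match_mean P s a b =
    measure_pmf.expectation (match_scores P s a b) (\<lambda>scores. real (total_games scores))"

text \<open>
  The rest of a match depends on the score of a set only through its winner and the parity of
  its number of games: \<open>w\<close> tells whether \<open>A\<close> wins the set, \<open>e\<close> whether that number is even.
\<close>

definition outcome_prob :: "(player \<Rightarrow> real) \<Rightarrow> player \<Rightarrow> bool \<Rightarrow> bool \<Rightarrow> real" where
  "outcome_prob P s w e = set_mean P (\<lambda>(i, j). of_bool ((j < i) = w \<and> even (i + j) = e)) s 0 0"

lemma set_mean_add:
  "set_mean P (\<lambda>x. f x + g x) s i j = set_mean P f s i j + set_mean P g s i j"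
  unfolding set_mean_def
  by (intro Bochner_Integration.integral_add integrable_measure_pmf_finite finite_set_score)

lemma set_mean_outcome:
  "set_mean P (\<lambda>(i, j). \<phi> (j < i) (even (i + j))) s 0 0
    = outcome_prob P s True True * \<phi> True True + outcome_prob P s True False * \<phi> True False
    + outcome_prob P s False True * \<phi> False True + outcome_prob P s False False * \<phi> False False"
proof -
  have "(\<lambda>(i :: nat, j :: nat). \<phi> (j < i) (even (i + j))) =
    (\<lambda>x. ((((case x of (i, j) \<Rightarrow> of_bool ((j < i) = True \<and> even (i + j) = True)) * \<phi> True True
      + (case x of (i, j) \<Rightarrow> of_bool ((j < i) = True \<and> even (i + j) = False)) * \<phi> True False)
      + (case x of (i, j) \<Rightarrow> of_bool ((j < i) = False \<and> even (i + j) = True)) * \<phi> False True)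
      + (case x of (i, j) \<Rightarrow> of_bool ((j < i) = False \<and> even (i + j) = False)) * \<phi> False False))"
    by auto
  then show ?thesis
    by (simp only: set_mean_add) (simp add: outcome_prob_def set_mean_def)
qed

lemma match_mean_over: "a \<ge> 2 \<or> b \<ge> 2 \<Longrightarrow> match_mean P s a b = 0"
  by (simp add: match_mean_def match_scores.simps[of P s a b] total_games_def)

lemma match_mean_step:
  fixes P s a b
  assumes "a < 2" "b < 2"
  defines "next_set \<equiv> \<lambda>w e. match_mean P (if e then s else opponent s)
      (if w then Suc a else a) (if w then b else Suc b)"
  shows "match_mean P s a b = set_mean P set_length s 0 0
    + (outcome_prob P s True True * next_set True True
     + outcome_prob P s True False * next_set True False
     + outcome_prob P s False True * next_set False True
     + outcome_prob P s False False * next_set False False)"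
proof -
  define rest where "rest = (\<lambda>(i :: nat, j :: nat).
    match_scores P (if even (i + j) then s else opponent s)
      (if j < i then Suc a else a) (if j < i then b else Suc b))"
  have "match_scores P s a b
      = bind_pmf (set_score P s 0 0) (\<lambda>x. map_pmf ((#) x) (rest x))"
    using assms(1,2)
    by (subst match_scores.simps) (auto simp: rest_def Let_def intro!: bind_pmf_cong)
  moreover have "finite (set_pmf (rest x))" for x
    by (cases x) (simp add: rest_def finite_match_scores)
  ultimately have "match_mean P s a b = set_mean P (\<lambda>x.
      measure_pmf.expectation (rest x) (\<lambda>l. set_length x + real (total_games l))) s 0 0"
    by (simp add: match_mean_def set_mean_def expectation_bind_finite finite_set_score
         total_games_def case_prod_unfold)
  also have "\<dots> = set_mean P (\<lambda>x. set_length x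
      + (case x of (i, j) \<Rightarrow> next_set (j < i) (even (i + j)))) s 0 0"
    using \<open>\<And>x. finite (set_pmf (rest x))\<close>
    by (intro arg_cong[where f = "\<lambda>f. set_mean P f s 0 0"])
      (auto simp: fun_eq_iff integrable_measure_pmf_finite next_set_def match_mean_def rest_def)
  also have "\<dots> = set_mean P set_length s 0 0
      + set_mean P (\<lambda>(i, j). next_set (j < i) (even (i + j))) s 0 0"
    by (rule set_mean_add)
  finally show ?thesis
    by (simp only: set_mean_outcome)
qed

lemma outcome_prob_nonneg: "0 \<le> outcome_prob P s w e"
  unfolding outcome_prob_def set_mean_def by (intro integral_nonneg_AE) auto

lemma outcome_prob_won:
  "outcome_prob P s True True + outcome_prob P s True False = set_mean P won_by_A s 0 0"
  using set_mean_outcome[of P "\<lambda>w e. of_bool w" s] by simp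

lemma outcome_prob_lost:
  "outcome_prob P s False True + outcome_prob P s False False = 1 - set_mean P won_by_A s 0 0"
  using set_mean_outcome[of P "\<lambda>w e. of_bool (\<not> w)" s]
    set_mean_outcome[of P "\<lambda>w e. 1" s] outcome_prob_won[of P s]
  by (simp add: set_mean_def case_prod_unfold)

text \<open>
  Given the first servers, the mean length of a set is its average over both servers plus or
  minus \<open>length_gap P 0 0 / 2\<close>, and the probability of a third set is \<open>2 * w * (1 - w)\<close> for
  either first server of the match. So the averages cancel, and the difference is a multiple of
  the gap: the summand 1 comes from the first set, \<open>u + v\<close> from the second and \<open>2 * u * v\<close>
  from the third. Here \<open>u\<close> is the probability that \<open>A\<close> wins a set with an even number of
  games minus that of winning one with an odd number, averaged over the two first servers;
  \<open>v\<close> is the same for \<open>B\<close>.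
\<close>

lemma T_match_diff:
  fixes P
  defines "w \<equiv> set_mean P won_by_A A 0 0"
  defines "u \<equiv> outcome_prob P A True True + outcome_prob P B True True - w"
    and "v \<equiv> outcome_prob P A False True + outcome_prob P B False True - (1 - w)"
  shows "T_match P A - T_match P B = length_gap P 0 0 * (1 + u + v + 2 * u * v)"
proof -
  have "set_mean P won_by_A B 0 0 = w"
    using won_by_A_indep_server[of 0 0 P A] by (simp add: w_def)
  then have odd: "outcome_prob P s True False = w - outcome_prob P s True True"
      "outcome_prob P s False False = 1 - w - outcome_prob P s False True" for s
    using outcome_prob_won[of P s] outcome_prob_lost[of P s] w_def by (cases s; simp)+
  note step = match_mean_step[of _ _ P] match_mean_over
  have third: "match_mean P s (Suc 0) (Suc 0) = set_mean P set_length s 0 0" for s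
    by (simp add: step)
  have T: "T_match P s = match_mean P s 0 0" for s
    by (simp add: T_match_def match_mean_def)
  show ?thesis
    unfolding T length_gap_def u_def v_def
    by (simp add: step third odd) algebra
qed

text \<open>
  Twice the expression is \<open>1 + (1 + 2 * u) * (1 + 2 * v)\<close>. At most one of the two factors of the
  product can be negative; if \<open>w \<le> 1 / 2\<close>, this is \<open>1 + 2 * v\<close>, and the product is
  smallest at \<open>u = w\<close>, \<open>v = - (1 - w)\<close>, where it is \<open>4 * w\<^sup>2 - 1\<close>.
\<close>

lemma match_factor_pos:
  fixes w u v :: real
  assumes "0 < w" "w < 1" "\<bar>u\<bar> \<le> w" "\<bar>v\<bar> \<le> 1 - w"
  shows "0 < 1 + u + v + 2 * u * v"
proof -
  have *: "- 1 < (1 + 2 * u) * (1 + 2 * v)"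
    if "0 < w" "w \<le> 1 / 2" "\<bar>u\<bar> \<le> w" "\<bar>v\<bar> \<le> 1 - w" for w u v :: real
  proof -
    have "- 1 < (1 + 2 * w) * (2 * w - 1)"
      using that by (simp add: algebra_simps)
    also have "\<dots> \<le> (1 + 2 * u) * (2 * w - 1)"
      using that by (intro mult_right_mono_neg) auto
    also have "\<dots> \<le> (1 + 2 * u) * (1 + 2 * v)"
      using that by (intro mult_left_mono) auto
    finally show ?thesis .
  qed
  have "- 1 < (1 + 2 * u) * (1 + 2 * v)"
  proof (cases "w \<le> 1 / 2")
    case True
    with assms show ?thesis by (intro *) auto
  next
    case False
    with assms have "- 1 < (1 + 2 * v) * (1 + 2 * u)"
      by (intro *[of "1 - w"]) auto
    then show ?thesis by (simp add: mult.commute)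
  qed
  then show ?thesis by (simp add: algebra_simps)
qed

section \<open>Comparison of the two matches\<close>

theorem proposition3p2:
  fixes P :: "player \<Rightarrow> real"
  assumes "0 < P A" "P A < 1"
    and "0 < P B" "P B < 1"
    and "G (P A) + G (P B) > 1"
    and "G (P A) > G (P B)"
  shows "T_match P A < T_match P B"
proof -
  note win = win_prob_eq[OF assms(1-4)]
  have wins: "0 < win_prob P A" "win_prob P A < 1" "0 < win_prob P B" "win_prob P B < 1"
    using G_pos G_less_1 assms(1-4) by (simp_all add: win)
  then have gap: "length_gap P 0 0 < 0"
    using assms(5,6) by (intro length_gap_start_neg) (simp_all add: win)
  define w where "w = set_mean P won_by_A A 0 0"
  have "set_mean P won_by_A B 0 0 = w"
    using won_by_A_indep_server[of 0 0 P A] by (simp add: w_def)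
  then have bounds: "0 \<le> outcome_prob P s True True" "outcome_prob P s True True \<le> w"
      "0 \<le> outcome_prob P s False True" "outcome_prob P s False True \<le> 1 - w" for s
    using outcome_prob_won[of P s] outcome_prob_lost[of P s] w_def
      outcome_prob_nonneg[of P s]
    by (smt (verit) player.exhaust)+
  have "T_match P A - T_match P B < 0"
    unfolding T_match_diff
    using bounds[of A] bounds[of B] won_by_A_strict[OF wins, of A]
    by (intro mult_neg_pos gap match_factor_pos[of w]) (auto simp: w_def)
  then show ?thesis by simp
qed

end
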